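(* Given a string $T$ of length $n$ (over an ordered alphabet, terminated by the unique smallest symbol $\$$), its Burrows–Wheeler transform $\mathsf{BWT}$ and its $\mathsf{LCP}$ array can be computed simultaneously in $O(n^2)$ time using $O(1)$ additional space, with the $\mathsf{BWT}$ computed in place, i.e. overwriting $T$.
   Context: Let $\Sigma$ be a totally ordered alphabet and $\$\notin\Sigma$ a symbol smaller than all symbols of $\Sigma$; $T=T[0]\cdots T[n-1]$ with $T[0,n-2]\in\Sigma^+$ and $T[n-1]=\$$, and $T_k=T[k,n-1]$. The suffix array $\mathsf{SA}$ is the permutation of $\{0,\dots,n-1\}$ with $T_{\mathsf{SA}[0]}<T_{\mathsf{SA}[1]}<\cdots<T_{\mathsf{SA}[n-1]}$ lexicographically. $\mathsf{BWT}[i]=T[\mathsf{SA}[i]-1]$ if $\mathsf{SA}[i]\neq0$ and $\mathsf{BWT}[i]=\$$ otherwise. $\mathsf{LCP}[0]=0$ and $\mathsf{LCP}[i]$ is the length of the longest common prefix of $T_{\mathsf{SA}[i]}$ and $T_{\mathsf{SA}[i-1]}$ for $1\le i<n$. Model: word RAM with words of $\Omega(\log n)$ bits; "in place" means the input array holding $T$ is overwritten by $\mathsf{BWT}$; "additional space" means memory beyond the array holding $T$/$\mathsf{BWT}$ and the output array holding $\mathsf{LCP}$ ($n$ integers), measured in words. *)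

theory Defs
  imports
    Complex_Main
    "HOL-Library.List_Lexorder"
    "HOL-Library.Sublist"
    "HOL-Library.Landau_Symbols"
begin

section \<open>Suffix array, Burrows--Wheeler transform and LCP array\<close>

definition is_text :: "'a::linorder set \<Rightarrow> 'a \<Rightarrow> 'a list \<Rightarrow> bool" where
  "is_text A dollar T \<longleftrightarrow>
     (\<forall>c\<in>A. dollar < c) \<and>
     (\<exists>u. u \<noteq> [] \<and> set u \<subseteq> A \<and> T = u @ [dollar])"

text \<open>The order on lists is the lexicographic one of \<^theory>\<open>HOL-Library.List_Lexorder\<close>.\<close>

definition is_suffix_array :: "'a::linorder list \<Rightarrow> nat list \<Rightarrow> bool" where
  "is_suffix_array T sa \<longleftrightarrow>
     distinct sa \<and> set sa = {..<length T} \<and>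
     sorted_wrt (\<lambda>i j. drop i T < drop j T) sa"

definition suffix_array :: "'a::linorder list \<Rightarrow> nat list" where
  "suffix_array T = (THE sa. is_suffix_array T sa)"

lemma is_suffix_array_ex1: "\<exists>!sa. is_suffix_array (T :: 'a::linorder list) sa"
proof -
  let ?f = "\<lambda>k. drop k T"
  have inj: "inj_on ?f {..<length T}"
    by (rule inj_onI) (metis diff_diff_cancel length_drop lessThan_iff less_imp_le_nat)
  have eq: "is_suffix_array T sa \<longleftrightarrow> sorted (map ?f sa) \<and> distinct sa \<and> set sa = {..<length T}"
    for sa
  proof -
    have "sorted_wrt (\<lambda>i j. ?f i < ?f j) sa \<longleftrightarrow> sorted (map ?f sa)"
      if "distinct sa" "set sa = {..<length T}"
    proof -
      have "distinct (map ?f sa)"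
        using that inj by (simp add: distinct_map)
      then show ?thesis
        using strict_sorted_iff[of "map ?f sa"] by (simp add: sorted_wrt_map)
    qed
    then show ?thesis
      unfolding is_suffix_array_def by blast
  qed
  show ?thesis
  proof (rule ex1I)
    show "is_suffix_array T (sort_key ?f [0..<length T])"
      unfolding eq by (simp add: atLeast0LessThan)
  next
    fix sa assume sa: "is_suffix_array T sa"
    let ?sb = "sort_key ?f [0..<length T]"
    have sets: "set sa = {..<length T}" "set ?sb = {..<length T}"
      using sa by (simp_all add: eq atLeast0LessThan)
    have "map ?f sa = map ?f ?sb"
    proof (rule sorted_distinct_set_unique)
      show "distinct (map ?f sa)" "distinct (map ?f ?sb)"
        using sa inj sets by (simp_all add: eq distinct_map)
      show "set (map ?f sa) = set (map ?f ?sb)"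
        unfolding set_map sets ..
    qed (use sa eq in auto)
    then show "sa = ?sb"
      using inj sets by (simp add: inj_on_map_eq_map)
  qed
qed

lemma is_suffix_array_suffix_array: "is_suffix_array T (suffix_array T)"
  unfolding suffix_array_def by (rule theI') (rule is_suffix_array_ex1)

definition bwt :: "'a::linorder \<Rightarrow> 'a list \<Rightarrow> 'a list" where
  "bwt dollar T =
     map (\<lambda>i. if suffix_array T ! i \<noteq> 0 then T ! (suffix_array T ! i - 1) else dollar)
       [0..<length T]"

definition lcp_array :: "'a::linorder list \<Rightarrow> nat list" where
  "lcp_array T =
     map (\<lambda>i. if i = 0 then 0
              else length (longest_common_prefix
                     (drop (suffix_array T ! i) T) (drop (suffix_array T ! (i - 1)) T)))
       [0..<length T]"


section \<open>A word RAM with a text array and an output array\<close>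

text \<open>
  A cell of the working memory holds either a word, i.e. a natural number below \<open>2 ^ w\<close> where \<open>w\<close>
  is the word size, or one symbol of the text. Symbols are opaque: they can be moved and compared,
  but a program can neither create one nor compute with it. In particular an entry of the text
  array can never store anything but a symbol occurring in the input.

  All addresses occurring in an instruction are addresses of the working memory. \<open>Load\<close> to
  \<open>LStore\<close> address their array indirectly, through a word in the working memory. A program is a
  finite list of instructions that depends neither on the input nor on \<open>w\<close>.
\<close>

datatype 'a cell = Word nat | Sym 'a

datatype binop =
  BAdd | BSub | BMul | BDiv | BMod | BAnd | BOr | BXor | BShl | BShr

datatype instr =
    Const nat nat
  | Move nat nat
  | Arith binop nat nat nat
  | Load nat nat          \<comment> \<open>\<open>Load d a\<close>: \<open>work[d] := work[work[a]]\<close>\<close>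
  | Store nat nat         \<comment> \<open>\<open>Store a s\<close>: \<open>work[work[a]] := work[s]\<close>\<close>
  | TLoad nat nat         \<comment> \<open>likewise for the text array\<close>
  | TStore nat nat
  | LLoad nat nat         \<comment> \<open>likewise for the output array\<close>
  | LStore nat nat
  | Jump nat
  | JumpEq nat nat nat    \<comment> \<open>\<open>JumpEq a b l\<close>: go to \<open>l\<close> if \<open>work[a] = work[b]\<close>\<close>
  | JumpLess nat nat nat
  | Halt

type_synonym program = "instr list"

record 'a config =
  pcount :: nat
  work :: "'a cell list"
  tarray :: "'a list"
  larray :: "nat list"

fun binop_val :: "nat \<Rightarrow> binop \<Rightarrow> nat \<Rightarrow> nat \<Rightarrow> nat" where
  "binop_val w BAdd x y = (x + y) mod 2 ^ w"
| "binop_val w BSub x y = (x + (2 ^ w - y)) mod 2 ^ w"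
| "binop_val w BMul x y = (x * y) mod 2 ^ w"
| "binop_val w BDiv x y = x div y"
| "binop_val w BMod x y = x mod y"
| "binop_val w BAnd x y = Bit_Operations.and x y"
| "binop_val w BOr x y = Bit_Operations.or x y"
| "binop_val w BXor x y = Bit_Operations.xor x y"
| "binop_val w BShl x y = push_bit y x mod 2 ^ w"
| "binop_val w BShr x y = drop_bit y x"

text \<open>
  All partial operations below yield \<^const>\<open>None\<close> on an out-of-range access and on an operand of
  the wrong sort; the machine is then stuck, which is different from having halted.
\<close>

definition get :: "'x list \<Rightarrow> nat \<Rightarrow> 'x option" where
  "get xs i = (if i < length xs then Some (xs ! i) else None)"

definition put :: "'x list \<Rightarrow> nat \<Rightarrow> 'x \<Rightarrow> 'x list option" where
  "put xs i x = (if i < length xs then Some (xs[i := x]) else None)"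

fun the_word :: "'a cell \<Rightarrow> nat option" where
  "the_word (Word x) = Some x"
| "the_word (Sym c) = None"

fun the_sym :: "'a cell \<Rightarrow> 'a option" where
  "the_sym (Word x) = None"
| "the_sym (Sym c) = Some c"

definition get_word :: "'a cell list \<Rightarrow> nat \<Rightarrow> nat option" where
  "get_word m i = Option.bind (get m i) the_word"

definition get_sym :: "'a cell list \<Rightarrow> nat \<Rightarrow> 'a option" where
  "get_sym m i = Option.bind (get m i) the_sym"

fun cell_eq :: "'a cell \<Rightarrow> 'a cell \<Rightarrow> bool option" where
  "cell_eq (Word x) (Word y) = Some (x = y)"
| "cell_eq (Sym c) (Sym d) = Some (c = d)"
| "cell_eq _ _ = None"

fun cell_less :: "'a::linorder cell \<Rightarrow> 'a cell \<Rightarrow> bool option" where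
  "cell_less (Word x) (Word y) = Some (x < y)"
| "cell_less (Sym c) (Sym d) = Some (c < d)"
| "cell_less _ _ = None"

definition next_pc :: "'a config \<Rightarrow> 'a config" where
  "next_pc s = s\<lparr>pcount := Suc (pcount s)\<rparr>"

definition set_work :: "nat \<Rightarrow> 'a cell \<Rightarrow> 'a config \<Rightarrow> 'a config option" where
  "set_work d v s = map_option (\<lambda>m. next_pc (s\<lparr>work := m\<rparr>)) (put (work s) d v)"

definition set_tarray :: "nat \<Rightarrow> 'a \<Rightarrow> 'a config \<Rightarrow> 'a config option" where
  "set_tarray i c s = map_option (\<lambda>t. next_pc (s\<lparr>tarray := t\<rparr>)) (put (tarray s) i c)"

definition set_larray :: "nat \<Rightarrow> nat \<Rightarrow> 'a config \<Rightarrow> 'a config option" where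
  "set_larray i x s = map_option (\<lambda>l. next_pc (s\<lparr>larray := l\<rparr>)) (put (larray s) i x)"

definition jump_if :: "nat \<Rightarrow> bool \<Rightarrow> 'a config \<Rightarrow> 'a config" where
  "jump_if l b s = (if b then s\<lparr>pcount := l\<rparr> else next_pc s)"

fun exec :: "nat \<Rightarrow> instr \<Rightarrow> 'a::linorder config \<Rightarrow> 'a config option" where
  "exec w (Const d x) s = set_work d (Word (x mod 2 ^ w)) s"
| "exec w (Move d a) s =
     Option.bind (get (work s) a) (\<lambda>v. set_work d v s)"
| "exec w (Arith f d a b) s =
     Option.bind (get_word (work s) a) (\<lambda>x.
     Option.bind (get_word (work s) b) (\<lambda>y. set_work d (Word (binop_val w f x y)) s))"
| "exec w (Load d a) s =
     Option.bind (get_word (work s) a) (\<lambda>i.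
     Option.bind (get (work s) i) (\<lambda>v. set_work d v s))"
| "exec w (Store a b) s =
     Option.bind (get_word (work s) a) (\<lambda>i.
     Option.bind (get (work s) b) (\<lambda>v. set_work i v s))"
| "exec w (TLoad d a) s =
     Option.bind (get_word (work s) a) (\<lambda>i.
     Option.bind (get (tarray s) i) (\<lambda>c. set_work d (Sym c) s))"
| "exec w (TStore a b) s =
     Option.bind (get_word (work s) a) (\<lambda>i.
     Option.bind (get_sym (work s) b) (\<lambda>c. set_tarray i c s))"
| "exec w (LLoad d a) s =
     Option.bind (get_word (work s) a) (\<lambda>i.
     Option.bind (get (larray s) i) (\<lambda>x. set_work d (Word x) s))"
| "exec w (LStore a b) s =
     Option.bind (get_word (work s) a) (\<lambda>i.
     Option.bind (get_word (work s) b) (\<lambda>x. set_larray i x s))"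
| "exec w (Jump l) s = Some (jump_if l True s)"
| "exec w (JumpEq a b l) s =
     Option.bind (get (work s) a) (\<lambda>u.
     Option.bind (get (work s) b) (\<lambda>v.
       map_option (\<lambda>c. jump_if l c s) (cell_eq u v)))"
| "exec w (JumpLess a b l) s =
     Option.bind (get (work s) a) (\<lambda>u.
     Option.bind (get (work s) b) (\<lambda>v.
       map_option (\<lambda>c. jump_if l c s) (cell_less u v)))"
| "exec w Halt s = None"

definition step :: "nat \<Rightarrow> program \<Rightarrow> 'a::linorder config \<Rightarrow> 'a config option" where
  "step w P s = Option.bind (get P (pcount s)) (\<lambda>i. exec w i s)"

definition halted :: "program \<Rightarrow> 'a config \<Rightarrow> bool" where
  "halted P s \<longleftrightarrow> get P (pcount s) = Some Halt"

definition halts_within ::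
    "nat \<Rightarrow> program \<Rightarrow> nat \<Rightarrow> 'a::linorder config \<Rightarrow> 'a config \<Rightarrow> bool" where
  "halts_within w P t s s' \<longleftrightarrow>
     (\<exists>k\<le>t. ((\<lambda>x y. step w P x = Some y) ^^ k) s s') \<and> halted P s'"

text \<open>
  The additional space is the size \<open>m\<close> of the working memory, which is fixed during a run. Its
  first cell initially contains the length of the text, the others contain \<open>0\<close>.
\<close>

definition init_config :: "nat \<Rightarrow> 'a list \<Rightarrow> nat list \<Rightarrow> 'a config" where
  "init_config m T L =
     \<lparr>pcount = 0, work = (replicate m (Word 0))[0 := Word (length T)], tarray = T, larray = L\<rparr>"

end

theory Submission
  imports Defs
begin

text \<open>
  The transform of the suffix starting at \<open>s + 1\<close> is turned into that of the suffix starting at \<open>s\<close>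
  (Crochemore, Grossi, Karkkainen and Landau). Let \<open>c = T ! s\<close> and let \<open>p\<close> be the row holding
  \<open>dollar\<close>, i.e. the row of the suffix at \<open>s + 1\<close>. By the LF mapping the suffixes smaller than the
  new one correspond to the rows holding a symbol smaller than \<open>c\<close> and the rows before \<open>p\<close> holding
  \<open>c\<close>; counting them gives the position of the new row. Then \<open>c\<close> replaces \<open>dollar\<close> in row \<open>p\<close>, the
  rows before the new one move down by one position and the new row receives \<open>dollar\<close>.

  The LCP of the new suffix with its predecessor is 0 if no row before \<open>p\<close> holds \<open>c\<close>, and otherwise
  one more than the minimum of the LCP values from behind the last such row up to \<open>p\<close>; symmetrically
  for the successor (Louza, Gagie and Telles). Each insertion takes two scans and one shift.
\<close>

section \<open>Inserting a suffix\<close>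

definition lcp :: "'a list \<Rightarrow> 'a list \<Rightarrow> nat" where
  "lcp xs ys = length (longest_common_prefix xs ys)"

lemma lcp_simps [simp]:
  "lcp [] ys = 0" "lcp xs [] = 0"
  "lcp (x # xs) (y # ys) = (if x = y then Suc (lcp xs ys) else 0)"
  by (simp_all add: lcp_def)

lemma lcp_commute: "lcp xs ys = lcp ys xs"
  by (induction xs ys rule: longest_common_prefix.induct) auto

lemma lcp_le_length: "lcp xs ys \<le> length xs"
  by (induction xs ys rule: longest_common_prefix.induct) auto

text \<open>A first symbol shared by the outer lists is squeezed onto the middle one, so induction
  strips it. This is why LCP values of distant rows are minima over the rows in between.\<close>

lemma lcp_between:
  fixes xs ys zs :: "'a::linorder list"
  assumes "xs \<le> ys" "ys \<le> zs"
  shows "lcp xs zs = min (lcp xs ys) (lcp ys zs)"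
  using assms
proof (induction xs arbitrary: ys zs)
  case (Cons x xs)
  then obtain y ys' where ys: "ys = y # ys'" by (cases ys) auto
  with Cons.prems obtain z zs' where zs: "zs = z # zs'" by (cases zs) auto
  show ?case
    using Cons.prems Cons.IH[of ys' zs'] by (auto simp: ys zs)
qed simp

section \<open>The arrays of the suffixes of a text\<close>

locale dollar_text =
  fixes T :: "'a::linorder list" and dollar :: 'a and n :: nat
  assumes length_T: "length T = n"
    and n_ge_2: "2 \<le> n"
    and last_T: "T ! (n - 1) = dollar"
    and dollar_less: "k < n - 1 \<Longrightarrow> dollar < T ! k"
begin

abbreviation suf :: "nat \<Rightarrow> 'a list" where
  "suf k \<equiv> drop k T"

lemma suf_Cons: "k < n \<Longrightarrow> suf k = T ! k # suf (Suc k)"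
  by (simp add: Cons_nth_drop_Suc length_T)

lemma suf_last: "suf (n - 1) = [dollar]"
  using suf_Cons[of "n - 1"] n_ge_2 last_T length_T by simp

text \<open>One of the two suffixes is proper, hence shorter than \<open>n\<close>. This later lets
  \<open>n\<close> act as infinity.\<close>

lemma lcp_suf_less: "k < n \<Longrightarrow> 0 < k \<or> 0 < l \<Longrightarrow> l < n \<Longrightarrow> lcp (suf k) (suf l) < n"
  using lcp_le_length[of "suf k" "suf l"] lcp_le_length[of "suf l" "suf k"] length_T
  by (auto simp: lcp_commute)

text \<open>The suffix starting at \<open>j\<close> is treated as a text of its own, so nothing
  precedes position \<open>j\<close>.\<close>

definition bwt_entry :: "nat \<Rightarrow> nat \<Rightarrow> 'a" where
  "bwt_entry j k = (if k = j then dollar else T ! (k - 1))"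

text \<open>Positions \<open>j..<n\<close> of the two arrays hold the transform and the LCP array of the suffix
  starting at \<open>j\<close>; row \<open>q\<close> belongs to the suffix starting at \<open>sa q\<close>.\<close>

definition stage :: "nat \<Rightarrow> (nat \<Rightarrow> nat) \<Rightarrow> 'a list \<Rightarrow> nat list \<Rightarrow> bool" where
  "stage j sa B L \<longleftrightarrow>
     length B = n \<and> length L = n \<and>
     sa ` {j..<n} = {j..<n} \<and>
     (\<forall>q q'. j \<le> q \<and> q < q' \<and> q' < n \<longrightarrow> suf (sa q) < suf (sa q')) \<and>
     (\<forall>q. j \<le> q \<and> q < n \<longrightarrow> B ! q = bwt_entry j (sa q)) \<and>
     (\<forall>q. q < j \<longrightarrow> B ! q = T ! q) \<and>
     (j < n \<longrightarrow> L ! j = 0) \<and>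
     (\<forall>q. j < q \<and> q < n \<longrightarrow> L ! q = lcp (suf (sa q)) (suf (sa (q - 1))))"

text \<open>The suffix \<open>[dollar]\<close> has one row, and \<open>T\<close> already ends in its
  transform; only the LCP entry needs a write.\<close>

lemma stage_init:
  assumes "length L = n"
  shows "stage (n - 1) id T (L[n - 1 := 0])"
  using assms n_ge_2 last_T length_T
  by (auto simp: stage_def bwt_entry_def)

lemma stage_final:
  assumes "stage 0 sa B L"
  shows "B = bwt dollar T" "L = lcp_array T"
proof -
  have n: "length B = n" "length L = n" and img: "sa ` {0..<n} = {0..<n}"
    and mono: "\<And>q q'. q < q' \<Longrightarrow> q' < n \<Longrightarrow> suf (sa q) < suf (sa q')"
    and B: "\<And>q. q < n \<Longrightarrow> B ! q = bwt_entry 0 (sa q)"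
    and L0: "L ! 0 = 0"
    and L: "\<And>q. 0 < q \<Longrightarrow> q < n \<Longrightarrow> L ! q = lcp (suf (sa q)) (suf (sa (q - 1)))"
    using assms n_ge_2 by (auto simp: stage_def)
  have "inj_on sa {0..<n}"
    using img by (simp add: eq_card_imp_inj_on)
  \<comment> \<open>Tabulating \<open>sa\<close> gives a suffix array; uniqueness then identifies it
    with \<open>suffix_array T\<close>.\<close>
  then have "is_suffix_array T (map sa [0..<n])"
    using img mono by (auto simp: is_suffix_array_def distinct_map length_T sorted_wrt_iff_nth_less)
  then have sa: "suffix_array T = map sa [0..<n]"
    using is_suffix_array_suffix_array is_suffix_array_ex1 by blast
  show "B = bwt dollar T"
    by (rule nth_equalityI) (auto simp: bwt_def sa n length_T B bwt_entry_def)
  show "L = lcp_array T"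
  proof (rule nth_equalityI)
    fix i assume "i < length L"
    then have i: "i < n"
      by (simp add: n)
    then have "lcp_array T ! i = (if i = 0 then 0 else lcp (suf (sa i)) (suf (sa (i - 1))))"
      by (simp add: lcp_array_def lcp_def sa length_T)
    then show "L ! i = lcp_array T ! i"
      using L[of i] L0 i by (cases "i = 0") simp_all
  qed (simp add: lcp_array_def n length_T)
qed
end

text \<open>Turns a count into a position: knowing how many rows are smaller tells where they
  end.\<close>

lemma downward_closed_eq_interval:
  fixes D :: "nat set"
  assumes "D \<subseteq> {s<..<n}" "\<And>q q'. q' \<in> D \<Longrightarrow> s < q \<Longrightarrow> q \<le> q' \<Longrightarrow> q \<in> D"
  shows "D = {s<..s + card D}"
proof (cases "D = {}")
  case False
  have fin: "finite D"
    using assms(1) finite_subset by blast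
  then have "D = {s<..Max D}"
    using assms(1) assms(2)[OF Max_in[OF fin False]] Max_ge[OF fin] by fastforce
  moreover have "s < Max D"
    using assms(1) Max_in[OF fin False] by auto
  ultimately show ?thesis
    by (metis card_greaterThanAtMost le_add_diff_inverse less_imp_le)
qed simp

section \<open>The LF mapping and the rank of the new suffix\<close>

locale insertion = dollar_text +
  fixes s :: nat and sa :: "nat \<Rightarrow> nat" and B :: "'a list" and L :: "nat list" and p :: nat
  assumes stage: "stage (Suc s) sa B L"
    and p: "s < p" "p < n" "sa p = Suc s"
begin

definition c :: 'a where
  "c = T ! s"

lemma
  shows length_B: "length B = n"
    and length_L: "length L = n"
    and image_sa: "sa ` {s<..<n} = {s<..<n}"
    and sa_mono: "s < q \<Longrightarrow> q < q' \<Longrightarrow> q' < n \<Longrightarrow> suf (sa q) < suf (sa q')"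
    and nth_B: "s < q \<Longrightarrow> q < n \<Longrightarrow> B ! q = bwt_entry (Suc s) (sa q)"
    and nth_B_le: "q \<le> s \<Longrightarrow> B ! q = T ! q"
    and nth_L_first: "L ! Suc s = 0"
    and nth_L: "s < q \<Longrightarrow> Suc q < n \<Longrightarrow> L ! Suc q = lcp (suf (sa q)) (suf (sa (Suc q)))"
proof -
  have *: "{Suc s..<n} = {s<..<n}"
    by auto
  show "sa ` {s<..<n} = {s<..<n}"
    using stage unfolding stage_def * by blast
qed (use stage p in \<open>auto simp: stage_def lcp_commute\<close>)

lemma sa_range: "s < q \<Longrightarrow> q < n \<Longrightarrow> s < sa q \<and> sa q < n"
  using image_sa by fastforce

lemma sa_less_iff:
  "s < q \<Longrightarrow> q < n \<Longrightarrow> s < q' \<Longrightarrow> q' < n \<Longrightarrow> suf (sa q) < suf (sa q') \<longleftrightarrow> q < q'"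
  by (metis sa_mono linorder_neqE_nat order_less_asym order_less_irrefl)

lemma sa_le_iff:
  "s < q \<Longrightarrow> q < n \<Longrightarrow> s < q' \<Longrightarrow> q' < n \<Longrightarrow> suf (sa q) \<le> suf (sa q') \<longleftrightarrow> q \<le> q'"
  using sa_less_iff[of q' q] by (simp add: not_less [symmetric])

lemma sa_eq_iff: "s < q \<Longrightarrow> q < n \<Longrightarrow> s < q' \<Longrightarrow> q' < n \<Longrightarrow> sa q = sa q' \<longleftrightarrow> q = q'"
  by (metis sa_mono linorder_neqE_nat order_less_irrefl)

lemma sa_eq_Suc_s_iff: "s < q \<Longrightarrow> q < n \<Longrightarrow> sa q = Suc s \<longleftrightarrow> q = p"
  using sa_eq_iff[of q p] p by simp

lemma dollar_less_c: "dollar < c"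
  using dollar_less[of s] p by (simp add: c_def)

lemma suf_s: "suf s = c # suf (sa p)"
  using suf_Cons[of s] p by (simp add: c_def)

lemma B_p: "B ! p = dollar"
  using nth_B p by (simp add: bwt_entry_def)

lemma B_eq_dollar_iff: "s < q \<Longrightarrow> q < n \<Longrightarrow> B ! q = dollar \<longleftrightarrow> q = p"
  using nth_B[of q] sa_eq_Suc_s_iff[of q] sa_range[of q] dollar_less[of "sa q - 1"]
  by (force simp: bwt_entry_def)

text \<open>The LF mapping, which sends the row of \<open>dollar\<close> to the last suffix.\<close>

definition lf :: "nat \<Rightarrow> nat" where
  "lf q = (if q = p then n - 1 else sa q - 1)"

text \<open>The entry of a row is the symbol in front of its suffix, so prepending it gives another
  suffix. Row \<open>p\<close> holds \<open>dollar\<close> instead and gives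
  \<open>[dollar]\<close>.\<close>

lemma suf_lf: "s < q \<Longrightarrow> q < n \<Longrightarrow> suf (lf q) = B ! q # (if q = p then [] else suf (sa q))"
  using nth_B[of q] sa_eq_Suc_s_iff[of q] sa_range[of q] suf_Cons[of "sa q - 1"] suf_last
  by (auto simp: lf_def bwt_entry_def)

text \<open>Off row \<open>p\<close> the values \<open>sa q - 1\<close> range over
  \<open>s + 1\<close> to \<open>n - 2\<close>; row \<open>p\<close> supplies the missing
  \<open>n - 1\<close>.\<close>

lemma bij_betw_lf: "bij_betw lf {s<..<n} {s<..<n}"
proof -
  have lf: "lf q \<in> {s<..<n}" if "q \<in> {s<..<n}" for q
    using that sa_range[of q] sa_eq_Suc_s_iff[of q] by (auto simp: lf_def)
  moreover have inj: "inj_on lf {s<..<n}"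
  proof (rule inj_onI)
    fix q q' assume q: "q \<in> {s<..<n}" "q' \<in> {s<..<n}" "lf q = lf q'"
    show "q = q'"
      using q sa_range[of q] sa_range[of q'] sa_eq_iff[of q q'] by (auto simp: lf_def split: if_splits)
  qed
  ultimately show ?thesis
    by (simp add: bij_betw_def image_subset_iff endo_inj_surj)
qed

definition precedes :: "nat \<Rightarrow> bool" where
  "precedes q \<longleftrightarrow> B ! q < c \<or> B ! q = c \<and> q < p"

text \<open>First symbols decide. On a tie the remainders are the suffixes of rows \<open>q\<close>
  and \<open>p\<close>, which are ordered like their rows.\<close>

lemma lf_less_iff:
  assumes "s < q" "q < n"
  shows "suf (lf q) < suf s \<longleftrightarrow> precedes q"
  using assms p B_p dollar_less_c sa_less_iff[of q p]
  by (auto simp: suf_lf suf_s precedes_def)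

definition smaller :: "nat \<Rightarrow> nat" where
  "smaller i = card {q. s < q \<and> q \<le> i \<and> precedes q}"

lemma smaller_s [simp]: "smaller s = 0"
  by (auto simp: smaller_def)

lemma smaller_Suc: "s \<le> i \<Longrightarrow> smaller (Suc i) = (if precedes (Suc i) then Suc (smaller i) else smaller i)"
proof -
  assume "s \<le> i"
  then have "{q. s < q \<and> q \<le> Suc i \<and> precedes q} =
    (if precedes (Suc i) then insert (Suc i) {q. s < q \<and> q \<le> i \<and> precedes q}
     else {q. s < q \<and> q \<le> i \<and> precedes q})"
    by (auto simp: le_Suc_eq)
  then show ?thesis
    by (auto simp: smaller_def)
qed

lemma smaller_le: "s \<le> i \<Longrightarrow> s + smaller i \<le> i"
  by (induction i rule: dec_induct) (auto simp: smaller_Suc)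

text \<open>The future row of the new suffix: the enlarged block starts at \<open>s\<close>, and the
  smaller suffixes fill it up to \<open>R - 1\<close>.\<close>

definition R :: nat where
  "R = s + smaller (n - 1)"

text \<open>The smaller suffixes are counted twice, through \<open>sa\<close> and through
  \<open>lf\<close>. Since rows are sorted, those holding them form an initial segment, which its
  size determines.\<close>

lemma rows_less_s: "{q \<in> {s<..<n}. suf (sa q) < suf s} = {s<..R}"
proof -
  let ?D = "{q \<in> {s<..<n}. suf (sa q) < suf s}" and ?I = "{s<..<n}"
  have inj: "inj_on sa ?I"
    using image_sa by (simp add: eq_card_imp_inj_on)
  have "card ?D = card (sa ` ?D)"
    by (rule card_image [symmetric]) (rule inj_on_subset[OF inj], auto)
  also have "sa ` ?D = {k \<in> ?I. suf k < suf s}"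
    using image_sa by (auto simp: image_iff set_eq_iff) (metis greaterThanLessThan_iff image_iff)+
  also have "\<dots> = lf ` {q \<in> ?I. precedes q}"
    using bij_betw_imp_surj_on[OF bij_betw_lf] lf_less_iff
    by (auto simp: image_iff set_eq_iff) (metis greaterThanLessThan_iff image_iff)+
  also have "card \<dots> = card {q \<in> ?I. precedes q}"
    by (rule card_image) (rule inj_on_subset[OF bij_betw_imp_inj_on[OF bij_betw_lf]], auto)
  also have "{q \<in> ?I. precedes q} = {q. s < q \<and> q \<le> n - 1 \<and> precedes q}"
    using n_ge_2 by auto
  finally have "s + card ?D = R"
    by (simp add: R_def smaller_def)
  moreover have "?D = {s<..s + card ?D}"
    by (rule downward_closed_eq_interval[where n = n])
      (auto intro: order.strict_trans1[OF iffD2[OF sa_le_iff], rotated -1])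
  ultimately show ?thesis
    by simp
qed

lemma R_less: "R < n"
proof -
  have "s \<le> n - 1"
    using p by simp
  then show ?thesis
    using smaller_le[of "n - 1"] p unfolding R_def by linarith
qed

text \<open>In the old numbering the new suffix falls between rows \<open>R\<close> and
  \<open>Suc R\<close>, which are therefore its neighbours.\<close>

lemma sa_less_s_iff: "s < q \<Longrightarrow> q < n \<Longrightarrow> suf (sa q) < suf s \<longleftrightarrow> q \<le> R"
  using rows_less_s by (auto simp: set_eq_iff)

lemma s_less_sa_iff: "s < q \<Longrightarrow> q < n \<Longrightarrow> suf s < suf (sa q) \<longleftrightarrow> R < q"
proof -
  assume q: "s < q" "q < n"
  have "suf s \<noteq> suf (sa q)"
    using sa_range[OF q] length_T by (metis diff_diff_cancel length_drop less_irrefl less_imp_le order.strict_trans)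
  then show ?thesis
    using sa_less_s_iff[OF q] by auto
qed

text \<open>Row \<open>p\<close> is always counted because \<open>dollar < c\<close>; hence the new
  suffix always has a predecessor.\<close>

lemma s_less_R: "s < R"
proof -
  have "precedes p"
    using B_p dollar_less_c by (simp add: precedes_def)
  then have "p \<in> {q. s < q \<and> q \<le> n - 1 \<and> precedes q}"
    using p by auto
  then have "smaller (n - 1) \<noteq> 0"
    unfolding smaller_def by (subst card_eq_0_iff) auto
  then show ?thesis
    by (simp add: R_def)
qed

text \<open>The running minimum \<open>m\<close> does not include row \<open>i + 1\<close> yet. The value 0 means that \<open>c\<close> has not
  been met, and \<open>n\<close> serves as infinity.\<close>

definition below :: "nat \<Rightarrow> nat \<Rightarrow> bool" where
  "below i m \<longleftrightarrow>
     (\<forall>q. s < q \<and> q \<le> i \<longrightarrow> B ! q \<noteq> c) \<and> m = 0 \<or>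
     (\<exists>a. s < a \<and> a \<le> i \<and> B ! a = c \<and> (\<forall>q. a < q \<and> q \<le> i \<longrightarrow> B ! q \<noteq> c) \<and>
       min m (Suc (L ! Suc i)) = Suc (lcp (suf (sa a)) (suf (sa (Suc i)))))"

definition above :: "nat \<Rightarrow> nat \<Rightarrow> nat \<Rightarrow> bool" where
  "above i m m' \<longleftrightarrow>
     m = (if i = p then n else Suc (lcp (suf (Suc s)) (suf (sa i)))) \<and>
     ((\<forall>q. p < q \<and> q \<le> i \<longrightarrow> B ! q \<noteq> c) \<and> m' = 0 \<or>
      (\<exists>b. p < b \<and> b \<le> i \<and> B ! b = c \<and> (\<forall>q. p < q \<and> q < b \<longrightarrow> B ! q \<noteq> c) \<and>
        m' = Suc (lcp (suf (Suc s)) (suf (sa b)))))"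

section \<open>Running minima and the LCP values of the new row\<close>

lemma L_less: "s < q \<Longrightarrow> q < n \<Longrightarrow> L ! q < n"
proof (cases q)
  case (Suc i)
  assume q: "s < q" "q < n"
  show ?thesis
  proof (cases "i = s")
    case False
    then show ?thesis
      using q Suc sa_range[of i] sa_range[of "Suc i"] by (simp add: nth_L lcp_suf_less)
  qed (use Suc q nth_L_first in simp)
qed simp

lemma lcp_sa_Suc:
  assumes "s < a" "a \<le> i" "Suc i < n"
  shows "lcp (suf (sa a)) (suf (sa (Suc i))) = min (lcp (suf (sa a)) (suf (sa i))) (L ! Suc i)"
  using assms lcp_between[of "suf (sa a)" "suf (sa i)" "suf (sa (Suc i))"]
  by (simp add: sa_le_iff nth_L)

lemma below_s: "below s 0"
  by (auto simp: below_def)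

text \<open>A row holding \<open>c\<close> restarts the minimum at \<open>n\<close>; before the
  first such row the value 0 absorbs every minimum.\<close>

lemma below_Suc:
  assumes "below i m" "s \<le> i" "Suc (Suc i) < n"
  shows "below (Suc i) (if B ! Suc i = c then n else min m (Suc (L ! Suc i)))"
proof (cases "B ! Suc i = c")
  case True
  \<comment> \<open>Hence \<open>n\<close> does not affect the next minimum, as infinity should
    not.\<close>
  have "L ! Suc (Suc i) < n"
    using assms L_less by simp
  then show ?thesis
    using True assms(2,3) by (auto simp: below_def nth_L intro!: exI[of _ "Suc i"])
next
  case False
  from assms(1) show ?thesis
    unfolding below_def[of i]
  proof (elim disjE conjE exE)
    assume "\<forall>q. s < q \<and> q \<le> i \<longrightarrow> B ! q \<noteq> c" "m = 0"
    then show ?thesis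
      using False by (auto simp: below_def le_Suc_eq)
  next
    fix a assume a: "s < a" "a \<le> i" "B ! a = c" "\<forall>q. a < q \<and> q \<le> i \<longrightarrow> B ! q \<noteq> c"
      "min m (Suc (L ! Suc i)) = Suc (lcp (suf (sa a)) (suf (sa (Suc i))))"
    have "min (Suc (lcp (suf (sa a)) (suf (sa (Suc i))))) (Suc (L ! Suc (Suc i)))
      = Suc (lcp (suf (sa a)) (suf (sa (Suc (Suc i)))))"
      using a(1,2) assms(3) by (simp add: lcp_sa_Suc[of a "Suc i"])
    then show ?thesis
      unfolding below_def using a False
      by (intro disjI2 exI[of _ a]) (auto simp: le_Suc_eq)
  qed
qed

lemma above_p: "above p n 0"
  by (auto simp: above_def)

text \<open>Behind \<open>p\<close> the nearest row holding \<open>c\<close> is the first one met,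
  so \<open>m'\<close> is frozen there while \<open>m\<close> keeps decreasing. All recorded values
  are positive, so 0 safely marks that none was met.\<close>

lemma above_Suc:
  assumes "above i m m'" "p \<le> i" "Suc i < n"
  defines "m2 \<equiv> min m (Suc (L ! Suc i))"
  shows "above (Suc i) m2 (if B ! Suc i = c \<and> m' = 0 then m2 else m')"
proof -
  have m2: "m2 = Suc (lcp (suf (Suc s)) (suf (sa (Suc i))))"
  proof (cases "i = p")
    case True
    then show ?thesis
      using assms p nth_L[of p] L_less[of "Suc p"] by (simp add: above_def)
  next
    case False
    then show ?thesis
      using assms p lcp_sa_Suc[of p i] by (simp add: above_def)
  qed
  from assms(1) show ?thesis
    unfolding above_def[of i]
  proof (elim disjE conjE exE)
    assume *: "\<forall>q. p < q \<and> q \<le> i \<longrightarrow> B ! q \<noteq> c" "m' = 0"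
    show ?thesis
    proof (cases "B ! Suc i = c")
      case True
      then show ?thesis
        using * m2 assms(2) by (auto simp: above_def intro!: exI[of _ "Suc i"])
    next
      case False
      then show ?thesis
        using * m2 assms(2) by (auto simp: above_def le_Suc_eq)
    qed
  next
    fix b assume "p < b" "b \<le> i" "B ! b = c" "\<forall>q. p < q \<and> q < b \<longrightarrow> B ! q \<noteq> c"
      "m' = Suc (lcp (suf (Suc s)) (suf (sa b)))"
    then show ?thesis
      unfolding above_def using m2 assms(2)
      by (intro conjI disjI2 exI[of _ b]) auto
  qed
qed

text \<open>If the neighbour of the new row starts with \<open>c\<close>, the suffix behind that \<open>c\<close> is the
  nearest row holding \<open>c\<close>, since otherwise a row in between would yield a closer neighbour.\<close>

lemma row_of_suf_starting_with_c:
  assumes "s < q" "q < n" "suf (sa q) = c # ys"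
  obtains a where "s < a" "a < n" "a \<noteq> p" "B ! a = c" "lf a = sa q" "ys = suf (sa a)"
proof -
  obtain a where a: "s < a" "a < n" "lf a = sa q"
    using bij_betw_imp_surj_on[OF bij_betw_lf] sa_range[OF assms(1,2)]
    by (metis greaterThanLessThan_iff image_iff)
  show ?thesis
    using a suf_lf[of a] assms(3) B_p dollar_less_c by (intro that[of a]) auto
qed

lemma row_of_c:
  assumes "s < a" "a < n" "B ! a = c"
  obtains q where "s < q" "q < n" "suf (sa q) = c # suf (sa a)"
proof -
  have "a \<noteq> p"
    using assms(3) B_p dollar_less_c by auto
  have "lf a \<in> {s<..<n}"
    using assms bij_betwE[OF bij_betw_lf] by auto
  then have "lf a \<in> sa ` {s<..<n}"
    unfolding image_sa .
  then obtain q where "s < q" "q < n" "sa q = lf a"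
    by auto
  then show ?thesis
    using that[of q] suf_lf[of a] assms \<open>a \<noteq> p\<close> by simp
qed

text \<open>\<open>below\<close> leaves out the LCP entry of the next row, so that of row
  \<open>p\<close> enters here; the extra one in \<open>m\<close> accounts for the shared
  \<open>c\<close>.\<close>

lemma lcp_pred:
  assumes "below (p - 1) m"
  shows "min m (Suc (L ! p)) = lcp (suf s) (suf (sa R))"
proof -
  note R = s_less_R R_less
  obtain y ys where y: "suf (sa R) = y # ys"
    using suf_Cons[of "sa R"] sa_range[of R] R by simp
  have less: "suf (sa R) < suf s"
    using sa_less_s_iff R by simp
  \<comment> \<open>Putting \<open>c\<close> before a row preceding \<open>p\<close> gives a suffix
    below the new one, hence at or before row \<open>R\<close>.\<close>
  have max: "c # suf (sa a) \<le> suf (sa R)" if a: "s < a" "a < p" "B ! a = c" for a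
  proof -
    obtain q where q: "s < q" "q < n" "suf (sa q) = c # suf (sa a)"
      by (rule row_of_c[of a]) (use a p in auto)
    moreover have "suf (sa a) < suf (sa p)"
      using a p(1,2) sa_less_iff by simp
    ultimately have "q \<le> R"
      using sa_less_s_iff[of q] by (simp add: suf_s)
    then show ?thesis
      using sa_le_iff[of q R] q R by simp
  qed
  show ?thesis
  proof (cases "y = c")
    case True
    then obtain a' where a': "s < a'" "a' < n" "B ! a' = c" "ys = suf (sa a')"
      using row_of_suf_starting_with_c[of R ys] R y by metis
    have "a' < p"
      using less y True a' p sa_less_iff[of a' p] by (simp add: suf_s)
    have le: "q \<le> p - 1 \<longleftrightarrow> q < p" for q
      using p by auto
    obtain a where a: "s < a" "a < p" "B ! a = c" "\<forall>q. a < q \<and> q < p \<longrightarrow> B ! q \<noteq> c"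
      "min m (Suc (L ! p)) = Suc (lcp (suf (sa a)) (suf (sa p)))"
      using assms a'(1,3) \<open>a' < p\<close> p(1) unfolding below_def le by auto
    \<comment> \<open>Maximality of row \<open>R\<close> gives one inequality; the choice of
      \<open>a\<close> as the last row before \<open>p\<close> holding \<open>c\<close> gives the
      other.\<close>
    have "a \<le> a'"
      using max[of a] a y True a' p sa_le_iff[of a a'] by simp
    moreover have "\<not> a < a'"
      using a(4) a'(3) \<open>a' < p\<close> by blast
    ultimately have "a = a'"
      by simp
    then show ?thesis
      using a a' y True by (simp add: suf_s lcp_commute)
  next
    case False
    then have "y < c"
      using less y by (simp add: suf_s)
    then have "\<not> (s < a \<and> a < p \<and> B ! a = c)" for a
      using max[of a] y by auto
    then have "m = 0"
      using assms p by (auto simp: below_def)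
    then show ?thesis
      using False y by (simp add: suf_s)
  qed
qed

lemma lcp_succ:
  assumes "above (n - 1) m m'" "Suc R < n"
  shows "m' = lcp (suf (sa (Suc R))) (suf s)"
proof -
  let ?R = "Suc R"
  have R: "s < ?R" "?R < n"
    using s_less_R assms(2) by auto
  obtain y ys where y: "suf (sa ?R) = y # ys"
    using suf_Cons[of "sa ?R"] sa_range[of ?R] R by simp
  have less: "suf s < suf (sa ?R)"
    using s_less_sa_iff R by simp
  \<comment> \<open>The mirror image: rows behind \<open>p\<close> holding \<open>c\<close> yield
    suffixes above the new one.\<close>
  have min: "suf (sa ?R) \<le> c # suf (sa a)" if a: "p < a" "a < n" "B ! a = c" for a
  proof -
    obtain q where q: "s < q" "q < n" "suf (sa q) = c # suf (sa a)"
      by (rule row_of_c[of a]) (use a p in auto)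
    moreover have "suf (sa p) < suf (sa a)"
      using a p(1,2) sa_less_iff by simp
    ultimately have "R < q"
      using s_less_sa_iff[of q] by (simp add: suf_s)
    then show ?thesis
      using sa_le_iff[of ?R q] q R by simp
  qed
  show ?thesis
  proof (cases "y = c")
    case True
    then obtain a' where a': "s < a'" "a' < n" "B ! a' = c" "ys = suf (sa a')"
      using row_of_suf_starting_with_c[of ?R ys] R y by metis
    have "p < a'"
      using less y True a' p sa_less_iff[of p a'] by (simp add: suf_s)
    moreover have "a' \<le> n - 1"
      using a' by simp
    ultimately obtain b where b: "p < b" "b \<le> n - 1" "B ! b = c" "\<forall>q. p < q \<and> q < b \<longrightarrow> B ! q \<noteq> c"
      "m' = Suc (lcp (suf (Suc s)) (suf (sa b)))"
      using assms(1) a'(3) unfolding above_def by blast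
    have "b < n"
      using b(2) p by simp
    then have "a' \<le> b"
      using min[of b] b y True a' p sa_le_iff[of a' b] by simp
    moreover have "\<not> a' < b"
      using b(4) a'(3) \<open>p < a'\<close> by blast
    ultimately have "a' = b"
      by simp
    then show ?thesis
      using b a' y True p by (simp add: suf_s lcp_commute)
  next
    case False
    then have "c < y"
      using less y by (auto simp: suf_s)
    then have "\<not> (p < a \<and> a \<le> n - 1 \<and> B ! a = c)" for a
      using min[of a] y p(1,2) by (auto simp: le_less_trans)
    then have "m' = 0"
      using assms(1) unfolding above_def by blast
    then show ?thesis
      using False y by (simp add: suf_s)
  qed
qed

section \<open>The arrays after the insertion\<close>

definition inserted_sa :: "nat \<Rightarrow> nat" where
  "inserted_sa q = (if q < R then sa (Suc q) else if q = R then s else sa q)"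

text \<open>All other neighbouring pairs stay neighbours, so only the LCP entries of the new row and
  its successor are recomputed. The pointwise form abstracts from the order of the writes.\<close>

lemma stage_inserted:
  assumes "length B' = n" "length L' = n"
    and B': "\<And>q. q < n \<Longrightarrow> B' ! q =
      (if q = R then dollar else B[p := c] ! (if s \<le> q \<and> q < R then Suc q else q))"
    and L': "\<And>q. q < n \<Longrightarrow> L' ! q =
      (if q = R then lcp (suf s) (suf (sa R))
       else if q = Suc R then lcp (suf (sa (Suc R))) (suf s)
       else L ! (if s \<le> q \<and> q < R then Suc q else q))"
  shows "stage s inserted_sa B' L'"
  unfolding stage_def
proof (intro conjI allI impI)
  note R = s_less_R R_less
  show "inserted_sa ` {s..<n} = {s..<n}"
  proof -
    have "{s..<n} = {s..<R} \<union> {R} \<union> {R<..<n}"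
      using R by auto
    moreover have "inserted_sa ` {s..<R} = sa ` Suc ` {s..<R}"
      unfolding image_image by (rule image_cong) (simp_all add: inserted_sa_def)
    moreover have Suc: "Suc ` {s..<R} = {s<..R}"
      unfolding image_Suc_atLeastLessThan by auto
    moreover have "inserted_sa ` {R<..<n} = sa ` {R<..<n}"
      by (auto simp: inserted_sa_def)
    ultimately have "inserted_sa ` {s..<n} = insert s (sa ` ({s<..R} \<union> {R<..<n}))"
      by (simp only: image_Un Suc image_insert image_empty)
        (simp add: inserted_sa_def[of R] Un_commute)
    also have "{s<..R} \<union> {R<..<n} = {s<..<n}"
      using R by auto
    finally show ?thesis
      using image_sa R by auto
  qed
  show "suf (inserted_sa q) < suf (inserted_sa q')" if "s \<le> q \<and> q < q' \<and> q' < n" for q q'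
    using that R sa_mono[of "Suc q" "Suc q'"] sa_mono[of "Suc q" q'] sa_mono[of q q']
      sa_less_s_iff[of "Suc q"] s_less_sa_iff[of q']
    by (auto simp: inserted_sa_def)
  \<comment> \<open>In the longer text the suffix at \<open>s + 1\<close> is preceded by
    \<open>c\<close>, so only row \<open>p\<close> changes.\<close>
  have B_upd: "B[p := c] ! q = bwt_entry s (sa q)" if "s < q" "q < n" for q
    using that p length_B nth_B[of q] sa_range[of q] sa_eq_Suc_s_iff[of q]
    by (auto simp: bwt_entry_def c_def nth_list_update)
  show "B' ! q = bwt_entry s (inserted_sa q)" if "s \<le> q \<and> q < n" for q
    using that R B'[of q] B_upd[of q] B_upd[of "Suc q"]
    by (auto simp: inserted_sa_def bwt_entry_def)
  show "B' ! q = T ! q" if "q < s" for q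
    using that R p B'[of q] nth_B_le[of q] by simp
  \<comment> \<open>As \<open>s < R\<close>, the old first row stays first and brings its 0
    along.\<close>
  show "L' ! s = 0"
    using L'[of s] R nth_L_first by simp
  show "L' ! q = lcp (suf (inserted_sa q)) (suf (inserted_sa (q - 1)))" if "s < q \<and> q < n" for q
    using that R L'[of q] nth_L[of q] nth_L[of "q - 1"]
    by (auto simp: inserted_sa_def lcp_commute)
qed (use assms in auto)

end

section \<open>The program\<close>

definition reaches ::
    "nat \<Rightarrow> program \<Rightarrow> nat \<Rightarrow> 'a::linorder config \<Rightarrow> ('a config \<Rightarrow> bool) \<Rightarrow> bool" where
  "reaches w P t s Q \<longleftrightarrow> (\<exists>k\<le>t. \<exists>s'. ((\<lambda>x y. step w P x = Some y) ^^ k) s s' \<and> Q s')"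

lemma reaches_refl: "Q s \<Longrightarrow> reaches w P t s Q"
  unfolding reaches_def by (intro exI[of _ 0]) auto

lemma reaches_step:
  assumes "step w P s = Some s'" "reaches w P t s' Q"
  shows "reaches w P (Suc t) s Q"
proof -
  obtain k s'' where "k \<le> t" "((\<lambda>x y. step w P x = Some y) ^^ k) s' s''" "Q s''"
    using assms(2) unfolding reaches_def by blast
  then show ?thesis
    unfolding reaches_def using assms(1) relpowp_Suc_I2
    by (intro exI[of _ "Suc k"] conjI exI[of _ s'']) fastforce+
qed

lemma reaches_trans:
  assumes "reaches w P t s Q" "\<And>s'. Q s' \<Longrightarrow> reaches w P t' s' Q'"
  shows "reaches w P (t + t') s Q'"
proof -
  obtain k s1 where 1: "k \<le> t" "((\<lambda>x y. step w P x = Some y) ^^ k) s s1" "Q s1"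
    using assms(1) unfolding reaches_def by blast
  obtain k' s2 where 2: "k' \<le> t'" "((\<lambda>x y. step w P x = Some y) ^^ k') s1 s2" "Q' s2"
    using assms(2)[OF 1(3)] unfolding reaches_def by blast
  have "((\<lambda>x y. step w P x = Some y) ^^ (k + k')) s s2"
    using 1(2) 2(2) by (auto simp: relpowp_add)
  then show ?thesis
    unfolding reaches_def using 1(1) 2(1,3) by (intro exI[of _ "k + k'"]) auto
qed

lemma reaches_weaken: "reaches w P t s Q \<Longrightarrow> (\<And>s'. Q s' \<Longrightarrow> Q' s') \<Longrightarrow> reaches w P t s Q'"
  unfolding reaches_def by blast

lemma reaches_mono: "reaches w P t s Q \<Longrightarrow> t \<le> t' \<Longrightarrow> reaches w P t' s Q"
  unfolding reaches_def using order_trans by blast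

lemma reaches_loop:
  assumes "I a s" "a \<le> b"
    and "\<And>i s. a \<le> i \<Longrightarrow> i < b \<Longrightarrow> I i s \<Longrightarrow> reaches w P t s (I (Suc i))"
  shows "reaches w P ((b - a) * t) s (I b)"
  using assms(2,3)
proof (induction b rule: dec_induct)
  case base
  then show ?case
    using assms(1) by (simp add: reaches_refl)
next
  case (step b)
  have "reaches w P ((b - a) * t + t) s (I (Suc b))"
    using step by (intro reaches_trans[where Q = "I b"]) simp_all
  with step(1) show ?case
    by (simp add: Suc_diff_le add.commute)
qed

text \<open>
  Working memory: 0 length, 1 start of the new suffix, 2 \<open>dollar\<close>, 3 first symbol of the new suffix,
  4 current row, 5 and 6 scratch, 7 row of the new suffix,
  8 LCP with its predecessor, 9 running minimum, 10 LCP with its successor,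
  11 constant one, 12 constant zero.
\<close>

definition prog :: program where
  "prog = [
     Const 11 1,
     Arith BSub 1 0 11,
     TLoad 2 1,
     LStore 1 12,
     JumpEq 1 12 55,     \<comment> \<open>4: head of the main loop\<close>
     Arith BSub 1 1 11,
     TLoad 3 1,
     Move 7 1,
     Move 4 1,
     Move 8 12,
     Arith BAdd 4 4 11,  \<comment> \<open>10: rows up to that of dollar\<close>
     LLoad 6 4,
     Arith BAdd 6 6 11,
     JumpLess 8 6 15,
     Move 8 6,
     TLoad 5 4,          \<comment> \<open>15\<close>
     JumpEq 5 2 22,
     JumpLess 3 5 10,
     Arith BAdd 7 7 11,
     JumpLess 5 3 10,
     Move 8 0,
     Jump 10,
     TStore 4 3,         \<comment> \<open>22: row of dollar\<close>
     Arith BAdd 7 7 11,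
     Move 9 0,
     Move 10 12,
     Arith BAdd 4 4 11,  \<comment> \<open>26: rows behind it\<close>
     JumpEq 4 0 40,
     LLoad 6 4,
     Arith BAdd 6 6 11,
     JumpLess 9 6 32,
     Move 9 6,
     TLoad 5 4,          \<comment> \<open>32\<close>
     JumpLess 3 5 26,
     JumpLess 5 3 38,
     JumpLess 12 10 26,
     Move 10 9,
     Jump 26,
     Arith BAdd 7 7 11,  \<comment> \<open>38\<close>
     Jump 26,
     Move 4 1,           \<comment> \<open>40\<close>
     JumpEq 4 7 49,      \<comment> \<open>41: shift the rows before the new one\<close>
     Arith BAdd 6 4 11,
     TLoad 5 6,
     TStore 4 5,
     LLoad 5 6,
     LStore 4 5,
     Move 4 6,
     Jump 41,
     TStore 4 2,         \<comment> \<open>49: the new row\<close>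
     LStore 4 8,
     Arith BAdd 4 4 11,
     JumpEq 4 0 4,
     LStore 4 10,
     Jump 4,
     Halt]"

text \<open>Symbolic execution: a literal budget counts down with each instruction, and a stuck
  machine makes the premise false.\<close>

lemma reaches_stepI:
  assumes "case step w P s of None \<Rightarrow> False | Some s' \<Rightarrow> reaches w P (pred_numeral t) s' Q"
  shows "reaches w P (numeral t) s Q"
  using assms reaches_step[of w P s _ "pred_numeral t" Q] by (simp add: numeral_eq_Suc split: option.splits)

lemma less_cases:
  fixes a b :: "'a::linorder"
  obtains "a < b" "\<not> b < a" "a \<le> b" "a \<noteq> b" | "a = b"
    | "b < a" "\<not> a < b" "\<not> a \<le> b" "a \<noteq> b"
  by (cases a b rule: linorder_cases) auto

text \<open>As a congruence rule it confines simplification to the budget and the state, leaving the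
  postcondition alone.\<close>

lemma reaches_cong: "t = t' \<Longrightarrow> s = s' \<Longrightarrow> reaches w P t s Q \<longleftrightarrow> reaches w P t' s' Q"
  by simp

lemma get_prog:
  "get prog 0 = Some (Const 11 1)"
  "get prog (Suc 0) = Some (Arith BSub 1 0 11)"
  "get prog 2 = Some (TLoad 2 1)"
  "get prog 3 = Some (LStore 1 12)"
  "get prog 4 = Some (JumpEq 1 12 55)"
  "get prog 5 = Some (Arith BSub 1 1 11)"
  "get prog 6 = Some (TLoad 3 1)"
  "get prog 7 = Some (Move 7 1)"
  "get prog 8 = Some (Move 4 1)"
  "get prog 9 = Some (Move 8 12)"
  "get prog 10 = Some (Arith BAdd 4 4 11)"
  "get prog 11 = Some (LLoad 6 4)"
  "get prog 12 = Some (Arith BAdd 6 6 11)"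
  "get prog 13 = Some (JumpLess 8 6 15)"
  "get prog 14 = Some (Move 8 6)"
  "get prog 15 = Some (TLoad 5 4)"
  "get prog 16 = Some (JumpEq 5 2 22)"
  "get prog 17 = Some (JumpLess 3 5 10)"
  "get prog 18 = Some (Arith BAdd 7 7 11)"
  "get prog 19 = Some (JumpLess 5 3 10)"
  "get prog 20 = Some (Move 8 0)"
  "get prog 21 = Some (Jump 10)"
  "get prog 22 = Some (TStore 4 3)"
  "get prog 23 = Some (Arith BAdd 7 7 11)"
  "get prog 24 = Some (Move 9 0)"
  "get prog 25 = Some (Move 10 12)"
  "get prog 26 = Some (Arith BAdd 4 4 11)"
  "get prog 27 = Some (JumpEq 4 0 40)"
  "get prog 28 = Some (LLoad 6 4)"
  "get prog 29 = Some (Arith BAdd 6 6 11)"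
  "get prog 30 = Some (JumpLess 9 6 32)"
  "get prog 31 = Some (Move 9 6)"
  "get prog 32 = Some (TLoad 5 4)"
  "get prog 33 = Some (JumpLess 3 5 26)"
  "get prog 34 = Some (JumpLess 5 3 38)"
  "get prog 35 = Some (JumpLess 12 10 26)"
  "get prog 36 = Some (Move 10 9)"
  "get prog 37 = Some (Jump 26)"
  "get prog 38 = Some (Arith BAdd 7 7 11)"
  "get prog 39 = Some (Jump 26)"
  "get prog 40 = Some (Move 4 1)"
  "get prog 41 = Some (JumpEq 4 7 49)"
  "get prog 42 = Some (Arith BAdd 6 4 11)"
  "get prog 43 = Some (TLoad 5 6)"
  "get prog 44 = Some (TStore 4 5)"
  "get prog 45 = Some (LLoad 5 6)"
  "get prog 46 = Some (LStore 4 5)"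
  "get prog 47 = Some (Move 4 6)"
  "get prog 48 = Some (Jump 41)"
  "get prog 49 = Some (TStore 4 2)"
  "get prog 50 = Some (LStore 4 8)"
  "get prog 51 = Some (Arith BAdd 4 4 11)"
  "get prog 52 = Some (JumpEq 4 0 4)"
  "get prog 53 = Some (LStore 4 10)"
  "get prog 54 = Some (Jump 4)"
  "get prog 55 = Some (Halt)"
  by (simp_all add: get_def prog_def)

lemma get_cells:
  "get [x0, x1, x2, x3, x4, x5, x6, x7, x8, x9, x10, x11, x12] 0 = Some x0"
  "get [x0, x1, x2, x3, x4, x5, x6, x7, x8, x9, x10, x11, x12] (Suc 0) = Some x1"
  "get [x0, x1, x2, x3, x4, x5, x6, x7, x8, x9, x10, x11, x12] 2 = Some x2"
  "get [x0, x1, x2, x3, x4, x5, x6, x7, x8, x9, x10, x11, x12] 3 = Some x3"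
  "get [x0, x1, x2, x3, x4, x5, x6, x7, x8, x9, x10, x11, x12] 4 = Some x4"
  "get [x0, x1, x2, x3, x4, x5, x6, x7, x8, x9, x10, x11, x12] 5 = Some x5"
  "get [x0, x1, x2, x3, x4, x5, x6, x7, x8, x9, x10, x11, x12] 6 = Some x6"
  "get [x0, x1, x2, x3, x4, x5, x6, x7, x8, x9, x10, x11, x12] 7 = Some x7"
  "get [x0, x1, x2, x3, x4, x5, x6, x7, x8, x9, x10, x11, x12] 8 = Some x8"
  "get [x0, x1, x2, x3, x4, x5, x6, x7, x8, x9, x10, x11, x12] 9 = Some x9"
  "get [x0, x1, x2, x3, x4, x5, x6, x7, x8, x9, x10, x11, x12] 10 = Some x10"
  "get [x0, x1, x2, x3, x4, x5, x6, x7, x8, x9, x10, x11, x12] 11 = Some x11"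
  "get [x0, x1, x2, x3, x4, x5, x6, x7, x8, x9, x10, x11, x12] 12 = Some x12"
  by (simp_all add: get_def)

lemma put_cells:
  "put [x0, x1, x2, x3, x4, x5, x6, x7, x8, x9, x10, x11, x12] 0 y = Some [y, x1, x2, x3, x4, x5, x6, x7, x8, x9, x10, x11, x12]"
  "put [x0, x1, x2, x3, x4, x5, x6, x7, x8, x9, x10, x11, x12] (Suc 0) y = Some [x0, y, x2, x3, x4, x5, x6, x7, x8, x9, x10, x11, x12]"
  "put [x0, x1, x2, x3, x4, x5, x6, x7, x8, x9, x10, x11, x12] 2 y = Some [x0, x1, y, x3, x4, x5, x6, x7, x8, x9, x10, x11, x12]"
  "put [x0, x1, x2, x3, x4, x5, x6, x7, x8, x9, x10, x11, x12] 3 y = Some [x0, x1, x2, y, x4, x5, x6, x7, x8, x9, x10, x11, x12]"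
  "put [x0, x1, x2, x3, x4, x5, x6, x7, x8, x9, x10, x11, x12] 4 y = Some [x0, x1, x2, x3, y, x5, x6, x7, x8, x9, x10, x11, x12]"
  "put [x0, x1, x2, x3, x4, x5, x6, x7, x8, x9, x10, x11, x12] 5 y = Some [x0, x1, x2, x3, x4, y, x6, x7, x8, x9, x10, x11, x12]"
  "put [x0, x1, x2, x3, x4, x5, x6, x7, x8, x9, x10, x11, x12] 6 y = Some [x0, x1, x2, x3, x4, x5, y, x7, x8, x9, x10, x11, x12]"
  "put [x0, x1, x2, x3, x4, x5, x6, x7, x8, x9, x10, x11, x12] 7 y = Some [x0, x1, x2, x3, x4, x5, x6, y, x8, x9, x10, x11, x12]"
  "put [x0, x1, x2, x3, x4, x5, x6, x7, x8, x9, x10, x11, x12] 8 y = Some [x0, x1, x2, x3, x4, x5, x6, x7, y, x9, x10, x11, x12]"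
  "put [x0, x1, x2, x3, x4, x5, x6, x7, x8, x9, x10, x11, x12] 9 y = Some [x0, x1, x2, x3, x4, x5, x6, x7, x8, y, x10, x11, x12]"
  "put [x0, x1, x2, x3, x4, x5, x6, x7, x8, x9, x10, x11, x12] 10 y = Some [x0, x1, x2, x3, x4, x5, x6, x7, x8, x9, y, x11, x12]"
  "put [x0, x1, x2, x3, x4, x5, x6, x7, x8, x9, x10, x11, x12] 11 y = Some [x0, x1, x2, x3, x4, x5, x6, x7, x8, x9, x10, y, x12]"
  "put [x0, x1, x2, x3, x4, x5, x6, x7, x8, x9, x10, x11, x12] 12 y = Some [x0, x1, x2, x3, x4, x5, x6, x7, x8, x9, x10, x11, y]"
  by (simp_all add: put_def numeral_eq_Suc)

lemma get_nth: "length xs = n \<Longrightarrow> i < n \<Longrightarrow> get xs i = Some (xs ! i)"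
  by (simp add: get_def)

lemma put_nth: "length xs = n \<Longrightarrow> i < n \<Longrightarrow> put xs i x = Some (xs[i := x])"
  by (simp add: put_def)

lemma halted_prog: "pcount s = 55 \<Longrightarrow> halted prog s"
  by (simp add: halted_def get_prog)

section \<open>The effect of each program segment\<close>

locale machine =
  fixes w n :: nat and dollar :: "'a::linorder"
  assumes n_less: "n < 2 ^ w" and two_le_n: "2 \<le> n"
begin

definition conf :: "nat \<Rightarrow> nat \<Rightarrow> 'a cell \<Rightarrow> 'a cell \<Rightarrow> 'a cell \<Rightarrow> 'a cell \<Rightarrow> 'a cell \<Rightarrow> 'a cell \<Rightarrow>
    'a cell \<Rightarrow> 'a cell \<Rightarrow> 'a list \<Rightarrow> nat list \<Rightarrow> 'a config" where
  "conf pc s c i x y r m m1 m2 B L =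
     \<lparr>pcount = pc,
      work = [Word n, Word s, Sym dollar, c, i, x, y, r, m, m1, m2, Word (Suc 0), Word 0],
      tarray = B, larray = L\<rparr>"

text \<open>Results stay at most \<open>n < 2 ^ w\<close>, so nothing wraps around. This lemma and
  \<open>BSub_one\<close> replace the modular definitions in simplification.\<close>

lemma BAdd_one: "i < n \<Longrightarrow> binop_val w BAdd i (Suc 0) = Suc i"
  using n_less by simp

lemma BSub_one: "0 < i \<Longrightarrow> i \<le> n \<Longrightarrow> binop_val w BSub i (Suc 0) = i - 1"
proof -
  assume i: "0 < i" "i \<le> n"
  then have "i + (2 ^ w - Suc 0) = (i - 1) + 2 ^ w"
    by simp
  then have "binop_val w BSub i (Suc 0) = (i - 1) mod 2 ^ w"
    by simp
  then show ?thesis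
    using i n_less by simp
qed

lemmas machine_simps = conf_def step_def get_prog get_cells put_cells get_nth put_nth get_word_def
  get_sym_def set_work_def set_tarray_def set_larray_def next_pc_def jump_if_def numeral_2_eq_2 [symmetric] BAdd_one BSub_one

declare binop_val.simps(1,2) [simp del]

text \<open>The longest path through a segment has 12 instructions, so 14 serves as a common budget.
  Ties are counted here, in front of the row of \<open>dollar\<close>.\<close>

lemma scan_step:
  assumes "length B = n" "length L = n" "Suc i < n" "r < n" "L ! Suc i < n" "B ! Suc i \<noteq> dollar"
  shows "reaches w prog 14 (conf 10 s (Sym c) (Word i) x y (Word r) (Word m) m1 m2 B L)
    (\<lambda>s'. \<exists>x y. s' = conf 10 s (Sym c) (Word (Suc i)) x y
       (Word (if B ! Suc i \<le> c then Suc r else r))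
       (Word (if B ! Suc i = c then n else min m (Suc (L ! Suc i)))) m1 m2 B L)"
  \<comment> \<open>The case splits decide every comparison on the path, so each instruction has a
    determined successor.\<close>
  by (insert assms, cases "m < Suc (L ! Suc i)"; cases rule: less_cases[of "B ! Suc i" c];
    ((rule reaches_refl, (simp add: conf_def; fail))
      | (rule reaches_stepI, simp add: machine_simps split del: if_split cong: reaches_cong))+)

lemma scan_end:
  assumes "length B = n" "length L = n" "Suc i < n" "r < n" "L ! Suc i < n" "B ! Suc i = dollar"
  shows "reaches w prog 14 (conf 10 s (Sym c) (Word i) x y (Word r) (Word m) m1 m2 B L)
    (\<lambda>s'. \<exists>x y. s' = conf 26 s (Sym c) (Word (Suc i)) x y (Word (Suc r))
       (Word (min m (Suc (L ! Suc i)))) (Word n) (Word 0) (B[Suc i := c]) L)"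
  by (insert assms, cases "m < Suc (L ! Suc i)";
    ((rule reaches_refl, (simp add: conf_def; fail))
      | (rule reaches_stepI, simp add: machine_simps split del: if_split cong: reaches_cong))+)

text \<open>Behind the row of \<open>dollar\<close> a tie no longer counts as smaller; it only fixes
  the LCP with the successor.\<close>

lemma behind_step:
  assumes "length B = n" "length L = n" "Suc i < n" "r < n" "L ! Suc i < n"
  shows "reaches w prog 14 (conf 26 s (Sym c) (Word i) x y (Word r) m (Word m1) (Word m2) B L)
    (\<lambda>s'. \<exists>x y. s' = conf 26 s (Sym c) (Word (Suc i)) x y
       (Word (if B ! Suc i < c then Suc r else r)) m
       (Word (min m1 (Suc (L ! Suc i))))
       (Word (if B ! Suc i = c \<and> m2 = 0 then min m1 (Suc (L ! Suc i)) else m2)) B L)"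
  by (insert assms, cases "m1 < Suc (L ! Suc i)"; cases "m2 = 0";
    cases rule: less_cases[of "B ! Suc i" c];
    ((rule reaches_refl, (simp add: conf_def; fail))
      | (rule reaches_stepI, simp add: machine_simps split del: if_split cong: reaches_cong))+)

lemma behind_end:
  assumes "Suc i = n"
  shows "reaches w prog 14 (conf 26 s c (Word i) x y r m m1 m2 B L)
    (\<lambda>s'. \<exists>x y. s' = conf 41 s c (Word s) x y r m m1 m2 B L)"
  by (insert assms,
    ((rule reaches_refl, (simp add: conf_def; fail))
      | (rule reaches_stepI, simp add: machine_simps split del: if_split cong: reaches_cong))+)

lemma shift_step:
  assumes "length B = n" "length L = n" "i < r" "r < n"
  shows "reaches w prog 14 (conf 41 s c (Word i) x y (Word r) m m1 m2 B L)
    (\<lambda>s'. \<exists>x y. s' = conf 41 s c (Word (Suc i)) x y (Word r) m m1 m2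
       (B[i := B ! Suc i]) (L[i := L ! Suc i]))"
  by (insert assms,
    ((rule reaches_refl, (simp add: conf_def; fail))
      | (rule reaches_stepI, simp add: machine_simps split del: if_split cong: reaches_cong))+)

text \<open>Registers that are written before they are read need not be tracked from one round to the
  next.\<close>

definition at_head :: "nat \<Rightarrow> 'a list \<Rightarrow> nat list \<Rightarrow> 'a config \<Rightarrow> bool" where
  "at_head s B L \<sigma> \<longleftrightarrow> (\<exists>c i x y r m m1 m2. \<sigma> = conf 4 s c i x y r m m1 m2 B L)"

lemma insert_row:
  assumes "length B = n" "length L = n" "r < n"
  shows "reaches w prog 14 (conf 41 s c (Word r) x y (Word r) (Word m) m1 (Word m2) B L)
    (at_head s (B[r := dollar]) (if Suc r < n then L[r := m, Suc r := m2] else L[r := m]))"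
  by (insert assms, unfold at_head_def, cases "Suc r < n";
    ((rule reaches_refl, (simp add: conf_def; fail))
      | (rule reaches_stepI, simp add: machine_simps split del: if_split cong: reaches_cong))+)

lemma head_step:
  assumes "length B = n" "0 < s" "s < n" "at_head s B L \<sigma>"
  shows "reaches w prog 14 \<sigma>
    (\<lambda>s'. \<exists>x y m1 m2. s' = conf 10 (s - 1) (Sym (B ! (s - 1))) (Word (s - 1)) x y
       (Word (s - 1)) (Word 0) m1 m2 B L)"
  by (insert assms, unfold at_head_def, elim exE, simp only:,
    ((rule reaches_refl, (simp add: conf_def; fail))
      | (rule reaches_stepI, simp add: machine_simps split del: if_split cong: reaches_cong))+)

lemma start:
  assumes "length B = n" "length L = n" "B ! (n - 1) = dollar"
  shows "reaches w prog 14 (init_config 13 B L) (at_head (n - 1) B (L[n - 1 := 0]))"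
proof -
  have init: "init_config 13 B L = \<lparr>pcount = 0,
      work = [Word n, Word 0, Word 0, Word 0, Word 0, Word 0, Word 0, Word 0, Word 0,
        Word 0, Word 0, Word 0, Word 0],
      tarray = B, larray = L\<rparr>"
    using assms by (simp add: init_config_def numeral_eq_Suc)
  \<comment> \<open>\<open>Const\<close> reduces modulo \<open>2 ^ w\<close>, so storing the
    constant one needs a positive word size.\<close>
  have w: "0 < w"
    using n_less two_le_n by (cases w) auto
  show ?thesis
    unfolding init at_head_def
    by (insert assms two_le_n w,
      
    ((rule reaches_refl, (simp add: conf_def; fail))
      | (rule reaches_stepI, simp add: machine_simps split del: if_split cong: reaches_cong))+)
qed

lemma finish:
  assumes "at_head 0 B L \<sigma>"
  shows "reaches w prog 14 \<sigma> (\<lambda>s'. pcount s' = 55 \<and> tarray s' = B \<and> larray s' = L)"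
  by (insert assms, unfold at_head_def, elim exE, simp only:,
    ((rule reaches_refl, (simp add: conf_def; fail))
      | (rule reaches_stepI, simp add: machine_simps split del: if_split cong: reaches_cong))+)

end

section \<open>Correctness and running time\<close>

definition shifted :: "nat \<Rightarrow> nat \<Rightarrow> 'a list \<Rightarrow> 'a list" where
  "shifted s i xs = map (\<lambda>q. xs ! (if s \<le> q \<and> q < i then Suc q else q)) [0..<length xs]"

lemma length_shifted [simp]: "length (shifted s i xs) = length xs"
  by (simp add: shifted_def)

lemma nth_shifted:
  "q < length xs \<Longrightarrow> shifted s i xs ! q = xs ! (if s \<le> q \<and> q < i then Suc q else q)"
  by (simp add: shifted_def)

lemma shifted_same: "shifted s s xs = xs"
  by (rule nth_equalityI) (auto simp: nth_shifted)

text \<open>\<open>shifted s i\<close> is an array halfway through the shift; moving upwards reads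
  each entry before it is overwritten.\<close>

lemma shifted_Suc:
  "s \<le> i \<Longrightarrow> Suc i < length xs \<Longrightarrow>
    (shifted s i xs)[i := shifted s i xs ! Suc i] = shifted s (Suc i) xs"
  by (rule nth_equalityI) (auto simp: nth_shifted nth_list_update less_Suc_eq)

context insertion
begin

lemma reaches_round:
  assumes "n < 2 ^ w" "machine.at_head n dollar (Suc s) B L \<sigma>"
  shows "reaches w prog (56 * n) \<sigma>
    (\<lambda>\<sigma>'. \<exists>sa B L. stage s sa B L \<and> machine.at_head n dollar s B L \<sigma>')"
proof -
  interpret machine w n dollar
    using assms(1) n_ge_2 by unfold_locales
  note R = s_less_R R_less
  define pred where "pred = lcp (suf s) (suf (sa R))"
  \<comment> \<open>The row counter starts at \<open>s\<close>, so after the last row it equals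
    \<open>R\<close>.\<close>
  define scan where "scan i \<sigma> \<longleftrightarrow> (\<exists>x y m m1 m2. below i m \<and>
    \<sigma> = conf 10 s (Sym c) (Word i) x y (Word (s + smaller i)) (Word m) m1 m2 B L)" for i \<sigma>
  define behind where "behind i \<sigma> \<longleftrightarrow> (\<exists>x y m1 m2. above i m1 m2 \<and>
    \<sigma> = conf 26 s (Sym c) (Word i) x y (Word (s + smaller i)) (Word pred) (Word m1) (Word m2)
      (B[p := c]) L)" for i \<sigma>
  \<comment> \<open>The successor's value is constrained only if the new row is not the last
    one.\<close>
  define shift where "shift i \<sigma> \<longleftrightarrow> (\<exists>x y m1 m2. (Suc R < n \<longrightarrow> m2 = lcp (suf (sa (Suc R))) (suf s)) \<and>
    \<sigma> = conf 41 s (Sym c) (Word i) x y (Word R) (Word pred) m1 (Word m2)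
      (shifted s i (B[p := c])) (shifted s i L))" for i \<sigma>
  have "reaches w prog 14 \<sigma> (scan s)"
  proof (rule reaches_weaken)
    show "reaches w prog 14 \<sigma>
      (\<lambda>s'. \<exists>x y m1 m2. s' = conf 10 (Suc s - 1) (Sym (B ! (Suc s - 1))) (Word (Suc s - 1)) x y
       (Word (Suc s - 1)) (Word 0) m1 m2 B L)"
      using assms(2) p length_B by (intro head_step) auto
  qed (use below_s nth_B_le[of s] in \<open>simp add: scan_def c_def, blast\<close>)
  moreover have "reaches w prog ((p - 1 - s) * 14) \<tau> (scan (p - 1))" if "scan s \<tau>" for \<tau>
  proof (rule reaches_loop[where I = scan, OF that])
    fix i \<tau> assume i: "s \<le> i" "i < p - 1" and "scan i \<tau>"
    then obtain x y m m1 m2 where m: "below i m"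
      and \<tau>: "\<tau> = conf 10 s (Sym c) (Word i) x y (Word (s + smaller i)) (Word m) m1 m2 B L"
      by (auto simp: scan_def)
    have B: "B ! Suc i \<noteq> dollar"
      using i p B_eq_dollar_iff[of "Suc i"] by auto
    have smaller: "s + smaller (Suc i) = (if B ! Suc i \<le> c then Suc (s + smaller i) else s + smaller i)"
      using i by (auto simp: smaller_Suc precedes_def)
    show "reaches w prog 14 \<tau> (scan (Suc i))"
      unfolding \<tau>
    proof (rule reaches_weaken[OF scan_step])
      show "Suc i < n" "s + smaller i < n" "L ! Suc i < n"
        using i p smaller_le[of i] L_less[of "Suc i"] by auto
      have "below (Suc i) (if B ! Suc i = c then n else min m (Suc (L ! Suc i)))"
        using below_Suc[OF m i(1)] i p by simp
      then show "scan (Suc i) s'" if "\<exists>x y. s' = conf 10 s (Sym c) (Word (Suc i)) x y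
          (Word (if B ! Suc i \<le> c then Suc (s + smaller i) else s + smaller i))
          (Word (if B ! Suc i = c then n else min m (Suc (L ! Suc i)))) m1 m2 B L" for s'
        using that unfolding scan_def smaller by blast
    qed (fact length_B length_L B)+
  qed (use p in auto)
  moreover have "reaches w prog 14 \<tau> (behind p)" if "scan (p - 1) \<tau>" for \<tau>
  proof -
    have p': "Suc (p - 1) = p" "s \<le> p - 1"
      using p by auto
    obtain x y m m1 m2 where m: "below (p - 1) m"
      and \<tau>: "\<tau> = conf 10 s (Sym c) (Word (p - 1)) x y (Word (s + smaller (p - 1))) (Word m) m1 m2 B L"
      using \<open>scan (p - 1) \<tau>\<close> unfolding scan_def by blast
    have "precedes p"
      using B_p dollar_less_c by (simp add: precedes_def)
    then have smaller: "smaller p = Suc (smaller (p - 1))"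
      using smaller_Suc[OF p'(2), unfolded p'(1)] by simp
    show ?thesis
      unfolding \<tau>
    proof (rule reaches_weaken[OF scan_end])
      show "s + smaller (p - 1) < n"
        using smaller_le[OF p'(2)] p by linarith
    qed (use length_B length_L p B_p L_less[of p] lcp_pred[OF m] above_p smaller in
      \<open>auto simp: p' behind_def pred_def\<close>)
  qed
  moreover have "reaches w prog ((n - 1 - p) * 14) \<tau> (behind (n - 1))" if "behind p \<tau>" for \<tau>
  proof (rule reaches_loop[where I = behind, OF that])
    fix i \<tau> assume i: "p \<le> i" "i < n - 1" and "behind i \<tau>"
    then obtain x y m1 m2 where m: "above i m1 m2"
      and \<tau>: "\<tau> = conf 26 s (Sym c) (Word i) x y (Word (s + smaller i)) (Word pred) (Word m1) (Word m2)
        (B[p := c]) L"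
      by (auto simp: behind_def)
    have smaller: "s + smaller (Suc i) = (if B ! Suc i < c then Suc (s + smaller i) else s + smaller i)"
      using i p by (auto simp: smaller_Suc precedes_def)
    have B: "B[p := c] ! Suc i = B ! Suc i"
      using i by simp
    have i': "Suc i < n"
      using i by simp
    show "reaches w prog 14 \<tau> (behind (Suc i))"
      unfolding \<tau>
    proof (rule reaches_weaken[OF behind_step])
      show "Suc i < n" "s + smaller i < n" "L ! Suc i < n"
        using i p smaller_le[of i] L_less[of "Suc i"] by auto
      show "behind (Suc i) s'" if "\<exists>x y. s' = conf 26 s (Sym c) (Word (Suc i)) x y
          (Word (if B[p := c] ! Suc i < c then Suc (s + smaller i) else s + smaller i)) (Word pred)
          (Word (min m1 (Suc (L ! Suc i))))
          (Word (if B[p := c] ! Suc i = c \<and> m2 = 0 then min m1 (Suc (L ! Suc i)) else m2))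
          (B[p := c]) L" for s'
        using that above_Suc[OF m i(1) i'] unfolding behind_def smaller B by blast
    qed (simp_all add: length_B length_L)
  qed (use p in auto)
  moreover have "reaches w prog 14 \<tau> (shift s)" if "behind (n - 1) \<tau>" for \<tau>
  proof -
    obtain x y m1 m2 where m: "above (n - 1) m1 m2"
      and \<tau>: "\<tau> = conf 26 s (Sym c) (Word (n - 1)) x y (Word R) (Word pred) (Word m1) (Word m2)
        (B[p := c]) L"
      using \<open>behind (n - 1) \<tau>\<close> unfolding behind_def R_def by blast
    show ?thesis
      unfolding \<tau>
      by (rule reaches_weaken[OF behind_end])
        (use p lcp_succ[OF m] in \<open>auto simp: shift_def shifted_same\<close>)
  qed
  moreover have "reaches w prog ((R - s) * 14) \<tau> (shift R)" if "shift s \<tau>" for \<tau>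
  proof (rule reaches_loop[where I = shift, OF that])
    fix i \<tau> assume i: "s \<le> i" "i < R" and "shift i \<tau>"
    then obtain x y m1 m2 where m: "Suc R < n \<longrightarrow> m2 = lcp (suf (sa (Suc R))) (suf s)"
      and \<tau>: "\<tau> = conf 41 s (Sym c) (Word i) x y (Word R) (Word pred) m1 (Word m2)
        (shifted s i (B[p := c])) (shifted s i L)"
      by (auto simp: shift_def)
    show "reaches w prog 14 \<tau> (shift (Suc i))"
      unfolding \<tau>
      by (rule reaches_weaken[OF shift_step])
        (use i R m length_B length_L in \<open>auto simp: shift_def shifted_Suc\<close>)
  qed (use R in auto)
  moreover have "reaches w prog 14 \<tau> (\<lambda>\<sigma>'. \<exists>sa B L. stage s sa B L \<and> at_head s B L \<sigma>')"
    if "shift R \<tau>" for \<tau>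
  proof -
    obtain x y m1 m2 where m: "Suc R < n \<longrightarrow> m2 = lcp (suf (sa (Suc R))) (suf s)"
      and \<tau>: "\<tau> = conf 41 s (Sym c) (Word R) x y (Word R) (Word pred) m1 (Word m2)
        (shifted s R (B[p := c])) (shifted s R L)"
      using \<open>shift R \<tau>\<close> unfolding shift_def by blast
    have "stage s inserted_sa ((shifted s R (B[p := c]))[R := dollar])
      (if Suc R < n then (shifted s R L)[R := pred, Suc R := m2] else (shifted s R L)[R := pred])"
      by (rule stage_inserted)
        (use length_B length_L m R in \<open>auto simp: nth_list_update nth_shifted pred_def\<close>)
    then show ?thesis
      unfolding \<tau>
      by (intro reaches_weaken[OF insert_row]) (use length_B length_L R in auto)
  qed
  ultimately have "reaches w prog
    (14 + ((p - 1 - s) * 14 + (14 + ((n - 1 - p) * 14 + (14 + ((R - s) * 14 + 14)))))) \<sigma>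
    (\<lambda>\<sigma>'. \<exists>sa B L. stage s sa B L \<and> at_head s B L \<sigma>')"
    by (blast intro: reaches_trans)
  then show ?thesis
    \<comment> \<open>Four single segments and fewer than \<open>2 * n\<close> loop passes, at 14
      steps each, stay within \<open>56 * n\<close> as \<open>n \<ge> 2\<close>.\<close>
    by (rule reaches_mono) (use p R in linarith)
qed

end

lemma (in dollar_text) reaches_final:
  assumes "n < 2 ^ w" "length L = n"
  shows "reaches w prog (56 * n\<^sup>2) (init_config 13 T L)
    (\<lambda>\<sigma>. halted prog \<sigma> \<and> tarray \<sigma> = bwt dollar T \<and> larray \<sigma> = lcp_array T)"
proof -
  interpret machine w n dollar
    using assms(1) n_ge_2 by unfold_locales
  \<comment> \<open>The index counts rounds upwards, as \<open>reaches_loop\<close> requires, while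
    the start of the suffix descends from \<open>n - 1\<close> to 0.\<close>
  define I where "I k \<sigma> \<longleftrightarrow> (\<exists>sa B L. stage (n - 1 - k) sa B L \<and> at_head (n - 1 - k) B L \<sigma>)" for k \<sigma>
  have "reaches w prog 14 (init_config 13 T L) (I 0)"
    by (rule reaches_weaken[OF start])
      (use length_T assms(2) last_T stage_init[OF assms(2)] in \<open>auto simp: I_def\<close>)
  moreover have "reaches w prog ((n - 1 - 0) * (56 * n)) \<sigma> (I (n - 1))" if "I 0 \<sigma>" for \<sigma>
  proof (rule reaches_loop[where I = I, OF that])
    fix k \<tau> assume k: "k < n - 1" and "I k \<tau>"
    define s where "s = n - 1 - Suc k"
    have s: "n - 1 - k = Suc s" "Suc s < n"
      using k by (auto simp: s_def)
    obtain sa B L where stage: "stage (Suc s) sa B L" and head: "at_head (Suc s) B L \<tau>"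
      using \<open>I k \<tau>\<close> unfolding I_def s(1) by blast
    then have "sa ` {Suc s..<n} = {Suc s..<n}"
      by (simp add: stage_def)
    then have "Suc s \<in> sa ` {Suc s..<n}"
      using s by simp
    \<comment> \<open>\<open>sa\<close> permutes the block, so the suffix at \<open>Suc s\<close>
      has a row, the one holding \<open>dollar\<close>.\<close>
    then obtain p where "p \<in> {Suc s..<n}" "sa p = Suc s"
      by (metis imageE)
    then interpret insertion T dollar n s sa B L p
      using stage by unfold_locales auto
    show "reaches w prog (56 * n) \<tau> (I (Suc k))"
      using reaches_round[OF assms(1) head] by (simp add: I_def [abs_def] s_def)
  qed simp
  moreover have "reaches w prog 14 \<sigma>
      (\<lambda>\<sigma>. halted prog \<sigma> \<and> tarray \<sigma> = bwt dollar T \<and> larray \<sigma> = lcp_array T)"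
    if "I (n - 1) \<sigma>" for \<sigma>
  proof -
    from that obtain sa B L where "stage 0 sa B L" and head: "at_head 0 B L \<sigma>"
      by (auto simp: I_def)
    then show ?thesis
      by (intro reaches_weaken[OF finish[OF head]]) (auto simp: halted_prog stage_final)
  qed
  ultimately have "reaches w prog (14 + ((n - 1 - 0) * (56 * n) + 14)) (init_config 13 T L)
    (\<lambda>\<sigma>. halted prog \<sigma> \<and> tarray \<sigma> = bwt dollar T \<and> larray \<sigma> = lcp_array T)"
    by (blast intro: reaches_trans)
  \<comment> \<open>There are only \<open>n - 1\<close> rounds, and the \<open>56 * n\<close> steps
    saved pay for start and finish.\<close>
  moreover have "14 + ((n - 1 - 0) * (56 * n) + 14) \<le> 56 * n\<^sup>2"
  proof -
    obtain k where "n = Suc k" "1 \<le> k"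
      using n_ge_2 by (cases n) auto
    then show ?thesis
      by (simp add: power2_eq_square algebra_simps)
  qed
  ultimately show ?thesis
    by (rule reaches_mono)
qed

theorem theorem1:
  shows "\<exists>(P :: program) (time :: nat \<Rightarrow> nat) (space :: nat \<Rightarrow> nat).
    (\<lambda>n. real (time n)) \<in> O(\<lambda>n. real n ^ 2) \<and>
    (\<lambda>n. real (space n)) \<in> O(\<lambda>n. 1) \<and>
    (\<forall>(A :: 'a::linorder set) (dollar :: 'a) (T :: 'a list) (w :: nat) (L :: nat list).
       is_text A dollar T \<and> length T < 2 ^ w \<and>
       length L = length T \<and> (\<forall>x\<in>set L. x < 2 ^ w) \<longrightarrow>
       (\<exists>s. halts_within w P (time (length T)) (init_config (space (length T)) T L) s \<and>
            tarray s = bwt dollar T \<and> larray s = lcp_array T))"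
proof (rule exI[of _ prog], rule exI[of _ "\<lambda>n. 56 * n\<^sup>2"], rule exI[of _ "\<lambda>n. 13"],
    intro conjI allI impI)
  show "(\<lambda>n. real (56 * n\<^sup>2)) \<in> O(\<lambda>n. real n ^ 2)" "(\<lambda>n :: nat. real 13) \<in> O(\<lambda>n. 1)"
    by simp_all
next
  fix A :: "'a set" and dollar :: 'a and T :: "'a list" and w :: nat and L :: "nat list"
  assume *: "is_text A dollar T \<and> length T < 2 ^ w \<and> length L = length T \<and> (\<forall>x\<in>set L. x < 2 ^ w)"
  then obtain u where u: "u \<noteq> []" "set u \<subseteq> A" "T = u @ [dollar]" and A: "\<forall>c\<in>A. dollar < c"
    by (auto simp: is_text_def)
  interpret dollar_text T dollar "length T"
  proof
    show "2 \<le> length T"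
      using u by (cases u) auto
    show "dollar < T ! k" if "k < length T - 1" for k
    proof -
      have "T ! k \<in> set u"
        using that u(3) by (simp add: nth_append)
      then show ?thesis
        using u(2) A by blast
    qed
  qed (simp_all add: u(3))
  show "\<exists>s. halts_within w prog (56 * (length T)\<^sup>2) (init_config 13 T L) s \<and>
      tarray s = bwt dollar T \<and> larray s = lcp_array T"
    using reaches_final[of w L] * unfolding reaches_def halts_within_def by blast
qed

end
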